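(* The coefficients $\mu_2=\mathrm{Tr}[(\Sigma A)^2]$ and $\mu_3=\mathrm{Tr}[(\Sigma A)^3]$ are given by $$\mu_2=\frac12\sum_{(\boldsymbol i,\boldsymbol j)\in\mathscr C_2}\prod_{p=1}^2v(I^{i_p}\cap J^{j_p})+\frac12\sum_{(i,j)\in\mathscr C_1}v_1(I^i)v_2(J^j),$$ $$\mu_3=\frac14\sum_{(\boldsymbol i,\boldsymbol j)\in\mathscr C_3}\prod_{p=1}^3v(I^{i_p}\cap J^{j_p})+\frac34\sum_{(\boldsymbol i,\boldsymbol j)\in\mathscr C_2}v_1(I^{i_1})v_2(J^{j_1})v(I^{i_2}\cap J^{j_2}).$$
   Context: Let $T>0$, $I^i=(S^{i-1},S^i]$, $1\le i\le N_1$, $0=S^0<\dots<S^{N_1}=T$, and $J^j=(T^{j-1},T^j]$, $1\le j\le N_2$, $0=T^0<\dots<T^{N_2}=T$. Let $\sigma_1,\sigma_2:[0,T]\to(0,\infty)$ and $\rho:[0,T]\to[-1,1]$ be deterministic functions (with the integrals below finite), and for Borel $S\subset[0,T]$ set $v(S)=\int_S\rho_t\sigma_{1,t}\sigma_{2,t}dt$, $v_1(S)=\int_S\sigma_{1,t}^2dt$, $v_2(S)=\int_S\sigma_{2,t}^2dt$. Put $N=N_1+N_2$. $A=(a_{\ell,\ell'})$ is the symmetric $N\times N$ matrix with $a_{\ell,\ell'}=\frac12$ if $\ell\le N_1<\ell'$ and $I^\ell\cap J^{\ell'-N_1}\ne\emptyset$, or if $\ell'\le N_1<\ell$ and $I^{\ell'}\cap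 J^{\ell-N_1}\neq\emptyset$, and $a_{\ell,\ell'}=0$ otherwise. $\Sigma=(\sigma_{\ell,\ell'})$ is the symmetric $N\times N$ matrix with $\sigma_{\ell,\ell'}=v(I^\ell\cap J^{\ell'-N_1})$ if $\ell\le N_1<\ell'$; $v(I^{\ell'}\cap J^{\ell-N_1})$ if $\ell'\le N_1<\ell$; $v_1(I^\ell)$ if $\ell=\ell'\le N_1$; $v_2(J^{\ell-N_1})$ if $\ell=\ell'>N_1$; and $0$ otherwise. A chain of length $k$ is a vector $(\boldsymbol i,\boldsymbol j)\in\{1,\dots,N_1\}^k\times\{1,\dots,N_2\}^k$ such that $I^{i_p}\cap J^{j_p}\ne\emptyset$ and $J^{j_p}\cap I^{i_{p+1}}\ne\emptyset$ for all $p\in\{1,\dots,k\}$, with $i_{k+1}=i_1$. $\mathscr C_k$ is the set of all chains of length $k$. *)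

theory Defs
  imports "HOL-Analysis.Analysis" "Jordan_Normal_Form.Matrix"
begin

definition grid :: "real \<Rightarrow> nat \<Rightarrow> (nat \<Rightarrow> real) \<Rightarrow> bool" where
  "grid T n s \<longleftrightarrow> s 0 = 0 \<and> s n = T \<and> (\<forall>i<n. s i < s (Suc i))"

definition grid_interval :: "(nat \<Rightarrow> real) \<Rightarrow> nat \<Rightarrow> real set" where
  "grid_interval s i = {s (i - 1)<..s i}"

definition covariation ::
    "(real \<Rightarrow> real) \<Rightarrow> (real \<Rightarrow> real) \<Rightarrow> (real \<Rightarrow> real) \<Rightarrow> real set \<Rightarrow> real" where
  "covariation \<rho> \<sigma>1 \<sigma>2 B = (LINT t:B|lebesgue. \<rho> t * \<sigma>1 t * \<sigma>2 t)"

definition variation :: "(real \<Rightarrow> real) \<Rightarrow> real set \<Rightarrow> real" where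
  "variation \<sigma> B = (LINT t:B|lebesgue. (\<sigma> t)\<^sup>2)"

text \<open>Entries are indexed from 1: the indices up to \<open>N1\<close> belong to the intervals \<open>I\<close>,
  and the index \<open>N1 + j\<close> belongs to \<open>J j\<close>. The matrices themselves are indexed from 0,
  hence the shift by \<open>Suc\<close>.\<close>

definition A_entry ::
    "nat \<Rightarrow> (nat \<Rightarrow> real set) \<Rightarrow> (nat \<Rightarrow> real set) \<Rightarrow> nat \<Rightarrow> nat \<Rightarrow> real" where
  "A_entry N1 I J l l' =
    (if l \<le> N1 \<and> N1 < l' \<and> I l \<inter> J (l' - N1) \<noteq> {}
        \<or> l' \<le> N1 \<and> N1 < l \<and> I l' \<inter> J (l - N1) \<noteq> {}
     then 1 / 2 else 0)"

definition A_mat ::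
    "nat \<Rightarrow> nat \<Rightarrow> (nat \<Rightarrow> real set) \<Rightarrow> (nat \<Rightarrow> real set) \<Rightarrow> real mat" where
  "A_mat N1 N2 I J =
    mat (N1 + N2) (N1 + N2) (\<lambda>(r, c). A_entry N1 I J (Suc r) (Suc c))"

definition Sigma_entry ::
    "nat \<Rightarrow> (nat \<Rightarrow> real set) \<Rightarrow> (nat \<Rightarrow> real set) \<Rightarrow>
     (real set \<Rightarrow> real) \<Rightarrow> (real set \<Rightarrow> real) \<Rightarrow> (real set \<Rightarrow> real) \<Rightarrow> nat \<Rightarrow> nat \<Rightarrow> real" where
  "Sigma_entry N1 I J v v1 v2 l l' =
    (if l \<le> N1 \<and> N1 < l' then v (I l \<inter> J (l' - N1))
     else if l' \<le> N1 \<and> N1 < l then v (I l' \<inter> J (l - N1))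
     else if l = l' \<and> l \<le> N1 then v1 (I l)
     else if l = l' \<and> N1 < l then v2 (J (l - N1))
     else 0)"

definition Sigma_mat ::
    "nat \<Rightarrow> nat \<Rightarrow> (nat \<Rightarrow> real set) \<Rightarrow> (nat \<Rightarrow> real set) \<Rightarrow>
     (real set \<Rightarrow> real) \<Rightarrow> (real set \<Rightarrow> real) \<Rightarrow> (real set \<Rightarrow> real) \<Rightarrow> real mat" where
  "Sigma_mat N1 N2 I J v v1 v2 =
    mat (N1 + N2) (N1 + N2) (\<lambda>(r, c). Sigma_entry N1 I J v v1 v2 (Suc r) (Suc c))"

definition mat_trace :: "'a :: comm_monoid_add mat \<Rightarrow> 'a" where
  "mat_trace M = (\<Sum>i<dim_row M. M $$ (i, i))"

text \<open>A vector of length \<open>k\<close> is a function on \<open>{1..k}\<close>, extensional so that each vector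
  is counted exactly once in sums over chains.\<close>

definition interval_chains ::
    "nat \<Rightarrow> nat \<Rightarrow> (nat \<Rightarrow> real set) \<Rightarrow> (nat \<Rightarrow> real set) \<Rightarrow> nat \<Rightarrow>
     ((nat \<Rightarrow> nat) \<times> (nat \<Rightarrow> nat)) set" where
  "interval_chains N1 N2 I J k =
    {(i, j). i \<in> {1..k} \<rightarrow>\<^sub>E {1..N1} \<and> j \<in> {1..k} \<rightarrow>\<^sub>E {1..N2} \<and>
      (\<forall>p\<in>{1..k}. I (i p) \<inter> J (j p) \<noteq> {} \<and>
                  J (j p) \<inter> I (i (if p = k then 1 else p + 1)) \<noteq> {})}"

end

theory Submission
  imports Defs
begin

text \<open>With respect to the splitting of the indices into the \<open>I\<close>-part and the \<open>J\<close>-part,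
  \<open>\<Sigma> = [[D1, X], [X\<^sup>T, D2]]\<close> and \<open>A = 1/2 [[0, H], [H\<^sup>T, 0]]\<close>, where \<open>D1\<close> and \<open>D2\<close> are
  diagonal, \<open>X i j = v (I i \<inter> J j)\<close> and \<open>H\<close> is the 0-1 matrix of the relation
  \<open>I i \<inter> J j \<noteq> {}\<close>. Hence \<open>\<Sigma> A = [[P, Q], [R, S]] = 1/2 [[X H\<^sup>T, D1 H], [D2 H\<^sup>T, X\<^sup>T H]]\<close>. By cyclicity and
  transposition invariance of the trace, the two diagonal blocks contribute equally, and so do
  all the products that involve off-diagonal blocks. The chain condition is the product of the
  entries of \<open>H\<close> along a closed path, up to factors \<open>H i j\<close> that are absorbed
  by \<open>X i j\<close> because \<open>v {} = 0\<close>.\<close>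

section \<open>Index splitting and traces of powers as sums over closed walks\<close>

lemma sum_lessThan_add_split:
  fixes f :: "nat \<Rightarrow> 'a :: comm_monoid_add"
  shows "(\<Sum>l<m + n. f l) = (\<Sum>i=1..m. f (i - 1)) + (\<Sum>j=1..n. f (m + j - 1))"
proof -
  have "(\<Sum>l<m + n. f l) = (\<Sum>l<m. f l) + (\<Sum>l<n. f (m + l))"
    by (induction n) (simp_all add: add.assoc)
  moreover have "(\<Sum>i=1..m. f (i - 1)) = (\<Sum>l<m. f l)"
    by (rule sum.reindex_bij_witness[of _ Suc "\<lambda>i. i - 1"]) auto
  moreover have "(\<Sum>j=1..n. f (m + j - 1)) = (\<Sum>l<n. f (m + l))"
    by (rule sum.reindex_bij_witness[of _ Suc "\<lambda>i. i - 1"]) auto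
  ultimately show ?thesis by simp
qed

lemma index_mult_mat_sum:
  assumes "X \<in> carrier_mat n m" "Y \<in> carrier_mat m k" "r < n" "c < k"
  shows "(X * Y) $$ (r, c) = (\<Sum>l<m. X $$ (r, l) * Y $$ (l, c))"
  using assms by (auto simp: scalar_prod_def atLeast0LessThan)

lemma mat_trace_square:
  fixes M :: "'a :: semiring_1 mat"
  assumes M: "M \<in> carrier_mat n n"
  shows "mat_trace (M ^\<^sub>m 2) = (\<Sum>r<n. \<Sum>s<n. M $$ (r, s) * M $$ (s, r))"
proof -
  have "M ^\<^sub>m 2 = M * M"
    using M by (simp add: numeral_2_eq_2)
  then show ?thesis
    using M by (simp add: mat_trace_def index_mult_mat_sum[OF M M] del: index_mult_mat(1))
qed

lemma mat_trace_cube: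
  fixes M :: "'a :: comm_semiring_1 mat"
  assumes M: "M \<in> carrier_mat n n"
  shows "mat_trace (M ^\<^sub>m 3) =
    (\<Sum>r<n. \<Sum>s<n. \<Sum>t<n. M $$ (r, s) * M $$ (s, t) * M $$ (t, r))"
proof -
  have MM: "M * M \<in> carrier_mat n n"
    using M by simp
  have "M ^\<^sub>m 3 = M * M * M"
    using M by (simp add: numeral_3_eq_3)
  then have "mat_trace (M ^\<^sub>m 3) = (\<Sum>r<n. (M * M * M) $$ (r, r))"
    using M by (simp add: mat_trace_def)
  also have "\<dots> = (\<Sum>r<n. \<Sum>t<n. \<Sum>s<n. M $$ (r, s) * M $$ (s, t) * M $$ (t, r))"
    by (simp add: index_mult_mat_sum[OF MM M] index_mult_mat_sum[OF M M] sum_distrib_right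
      del: index_mult_mat(1) assoc_mult_mat)
  \<comment> \<open>The product \<open>(M * M) * M\<close> expands with its last intermediate index
    t outside; the exchange restores the order of the closed walk r, s, t.\<close>
  also have "\<dots> = (\<Sum>r<n. \<Sum>s<n. \<Sum>t<n. M $$ (r, s) * M $$ (s, t) * M $$ (t, r))"
    by (intro sum.cong refl sum.swap)
  finally show ?thesis .
qed

section \<open>Sums over extensional vectors and exchanges of iterated sums\<close>

lemma sum_PiE_atLeastAtMost_Suc:
  "(\<Sum>g\<in>{1..Suc n} \<rightarrow>\<^sub>E B. f g) = (\<Sum>g\<in>{1..n} \<rightarrow>\<^sub>E B. \<Sum>b\<in>B. f (g(Suc n := b)))"
proof -
  \<comment> \<open>An extensional vector of length n + 1 corresponds to exactly one pair of a last
    entry and an extensional vector of length n.\<close>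
  have "bij_betw (\<lambda>(b, g). g(Suc n := b)) (B \<times> ({1..n} \<rightarrow>\<^sub>E B))
      (insert (Suc n) {1..n} \<rightarrow>\<^sub>E B)"
    by (intro bij_betw_imageI inj_combinator) (auto simp: PiE_insert_eq)
  from sum.reindex_bij_betw[OF this, of f]
  have "(\<Sum>g\<in>{1..Suc n} \<rightarrow>\<^sub>E B. f g) =
      (\<Sum>(b, g)\<in>B \<times> ({1..n} \<rightarrow>\<^sub>E B). f (g(Suc n := b)))"
    by (simp add: atLeastAtMostSuc_conv case_prod_unfold)
  also have "\<dots> = (\<Sum>b\<in>B. \<Sum>g\<in>{1..n} \<rightarrow>\<^sub>E B. f (g(Suc n := b)))"
    by (simp add: sum.cartesian_product)
  also have "\<dots> = (\<Sum>g\<in>{1..n} \<rightarrow>\<^sub>E B. \<Sum>b\<in>B. f (g(Suc n := b)))"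
    by (rule sum.swap)
  finally show ?thesis .
qed

lemma sum_PiE_1:
  "(\<Sum>g\<in>{1..1::nat} \<rightarrow>\<^sub>E B. f g) = (\<Sum>a\<in>B. f ((\<lambda>x. undefined)(1 := a)))"
  \<comment> \<open>The sole extensional function on the empty set is constantly
    \<open>undefined\<close>, which gives the base of the updates.\<close>
  using sum_PiE_atLeastAtMost_Suc[where n = 0 and B = B and f = f]
  by (simp add: fun_upd_def)

lemma sum_PiE_2:
  "(\<Sum>g\<in>{1..2::nat} \<rightarrow>\<^sub>E B. f g) = (\<Sum>a\<in>B. \<Sum>b\<in>B. f ((\<lambda>x. undefined)(1 := a, 2 := b)))"
  using sum_PiE_atLeastAtMost_Suc[where n = 1 and B = B and f = f]
  by (simp only: sum_PiE_1[unfolded One_nat_def] numeral_2_eq_2 One_nat_def)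

lemma sum_PiE_3:
  "(\<Sum>g\<in>{1..3::nat} \<rightarrow>\<^sub>E B. f g) =
    (\<Sum>a\<in>B. \<Sum>b\<in>B. \<Sum>c\<in>B. f ((\<lambda>x. undefined)(1 := a, 2 := b, 3 := c)))"
  using sum_PiE_atLeastAtMost_Suc[where n = 2 and B = B and f = f]
  by (simp only: sum_PiE_2 eval_nat_numeral(3))

lemma prod_of_bool:
  assumes "finite A"
  shows "(\<Prod>x\<in>A. of_bool (P x)) = (of_bool (\<forall>x\<in>A. P x) :: 'a :: comm_semiring_1)"
  using assms by induction (simp_all add: of_bool_conj)

text \<open>Grouping the variables into two pairs reduces this to one exchange of two sums. It
  carries sums over I-indices past sums over J-indices, which is how transposition invariance
  enters.\<close>

lemma sum_swap_blocks2:
  "(\<Sum>a\<in>A. \<Sum>b\<in>B. \<Sum>c\<in>C. \<Sum>d\<in>D. f a b c d) = (\<Sum>c\<in>C. \<Sum>d\<in>D. \<Sum>a\<in>A. \<Sum>b\<in>B. f a b c d)"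
  using sum.swap[of "\<lambda>(a, b) y. case y of (c, d) \<Rightarrow> f a b c d" "C \<times> D" "A \<times> B"]
  by (simp add: sum.cartesian_product')

lemma sum_swap_blocks3:
  "(\<Sum>a\<in>A. \<Sum>b\<in>B. \<Sum>c\<in>C. \<Sum>d\<in>D. \<Sum>e\<in>E. \<Sum>g\<in>G. f a b c d e g) =
   (\<Sum>d\<in>D. \<Sum>e\<in>E. \<Sum>g\<in>G. \<Sum>a\<in>A. \<Sum>b\<in>B. \<Sum>c\<in>C. f a b c d e g)"
  using sum.swap[of "\<lambda>(a, b, c) y. case y of (d, e, g) \<Rightarrow> f a b c d e g" "D \<times> E \<times> G" "A \<times> B \<times> C"]
  by (simp add: sum.cartesian_product')

section \<open>The blocks of \<Sigma> A\<close>

context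
  fixes N1 N2 :: nat and I J :: "nat \<Rightarrow> real set" and v v1 v2 :: "real set \<Rightarrow> real"
begin

text \<open>The entries of \<open>H\<close>, taken as reals so that chain conditions can be
  multiplied with values of \<open>v\<close>.\<close>

definition meets :: "nat \<Rightarrow> nat \<Rightarrow> real" where
  "meets i j = of_bool (I i \<inter> J j \<noteq> {})"

definition overlap :: "nat \<Rightarrow> nat \<Rightarrow> real" where
  "overlap i j = v (I i \<inter> J j)"

definition SA :: "real mat" where
  "SA = Sigma_mat N1 N2 I J v v1 v2 * A_mat N1 N2 I J"

lemma SA_carrier: "SA \<in> carrier_mat (N1 + N2) (N1 + N2)"
  unfolding SA_def Sigma_mat_def A_mat_def by (rule mult_carrier_mat) (rule mat_carrier)+

text \<open>The four blocks are P, Q, R, S in this order. Their arguments count from 1, as the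
  intervals do, whereas \<open>SA\<close> counts from 0.\<close>

definition SA11 :: "nat \<Rightarrow> nat \<Rightarrow> real" where
  "SA11 i i' = SA $$ (i - 1, i' - 1)"

definition SA12 :: "nat \<Rightarrow> nat \<Rightarrow> real" where
  "SA12 i j = SA $$ (i - 1, N1 + j - 1)"

definition SA21 :: "nat \<Rightarrow> nat \<Rightarrow> real" where
  "SA21 j i = SA $$ (N1 + j - 1, i - 1)"

definition SA22 :: "nat \<Rightarrow> nat \<Rightarrow> real" where
  "SA22 j j' = SA $$ (N1 + j - 1, N1 + j' - 1)"

text \<open>The middle index of the matrix product runs through the I-part and then the J-part. In
  each block one of the two sums vanishes, because \<open>A\<close> has zero diagonal
  blocks.\<close>

lemma SA_entry:
  assumes "r < N1 + N2" "c < N1 + N2"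
  shows "SA $$ (r, c) =
    (\<Sum>i=1..N1. Sigma_entry N1 I J v v1 v2 (Suc r) i * A_entry N1 I J i (Suc c)) +
    (\<Sum>j=1..N2. Sigma_entry N1 I J v v1 v2 (Suc r) (N1 + j) * A_entry N1 I J (N1 + j) (Suc c))"
proof -
  have "SA $$ (r, c) =
      (\<Sum>l<N1 + N2. Sigma_mat N1 N2 I J v v1 v2 $$ (r, l) * A_mat N1 N2 I J $$ (l, c))"
    unfolding SA_def by (rule index_mult_mat_sum[OF _ _ assms])
      (simp_all only: Sigma_mat_def A_mat_def mat_carrier)
  also have "\<dots> = (\<Sum>l<N1 + N2.
      Sigma_entry N1 I J v v1 v2 (Suc r) (Suc l) * A_entry N1 I J (Suc l) (Suc c))"
    using assms by (intro sum.cong refl) (simp add: Sigma_mat_def A_mat_def)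
  also have "\<dots> =
      (\<Sum>i=1..N1. Sigma_entry N1 I J v v1 v2 (Suc r) i * A_entry N1 I J i (Suc c)) +
      (\<Sum>j=1..N2. Sigma_entry N1 I J v v1 v2 (Suc r) (N1 + j) * A_entry N1 I J (N1 + j) (Suc c))"
    \<comment> \<open>Both new variables are at least 1, so the shifts cancel:
      \<open>Suc (i - 1) = i\<close> and \<open>Suc (N1 + j - 1) = N1 + j\<close>.\<close>
    unfolding sum_lessThan_add_split
    by (intro arg_cong2[where f = "(+)"] sum.cong refl) simp_all
  finally show ?thesis .
qed

lemma SA_block11:
  assumes "i \<in> {1..N1}" "i' \<in> {1..N1}"
  shows "SA11 i i' = (\<Sum>j=1..N2. overlap i j * meets i' j) / 2"
proof -
  have less: "i - 1 < N1 + N2" "i' - 1 < N1 + N2"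
    using assms by auto
  have "SA11 i i' =
      (\<Sum>l=1..N1. 0) +
      (\<Sum>l=1..N2. overlap i l * meets i' l / 2)"
    unfolding SA11_def SA_entry[OF less]
    by (intro arg_cong2[where f = "(+)"] sum.cong refl)
      (use assms in \<open>auto simp: Sigma_entry_def A_entry_def overlap_def meets_def\<close>)
  then show ?thesis by (simp add: sum_divide_distrib)
qed

lemma SA_block12:
  assumes "i \<in> {1..N1}" "j \<in> {1..N2}"
  shows "SA12 i j = v1 (I i) * meets i j / 2"
proof -
  have less: "i - 1 < N1 + N2" "N1 + j - 1 < N1 + N2"
    using assms by auto
  have "SA12 i j =
      (\<Sum>l=1..N1. if l = i then v1 (I i) * meets i j / 2 else 0) +
      (\<Sum>l=1..N2. 0)"
    unfolding SA12_def SA_entry[OF less]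
    by (intro arg_cong2[where f = "(+)"] sum.cong refl)
      (use assms in \<open>auto simp: Sigma_entry_def A_entry_def overlap_def meets_def\<close>)
  then show ?thesis using assms by simp
qed

lemma SA_block21:
  assumes "j \<in> {1..N2}" "i \<in> {1..N1}"
  shows "SA21 j i = v2 (J j) * meets i j / 2"
proof -
  have less: "N1 + j - 1 < N1 + N2" "i - 1 < N1 + N2"
    using assms by auto
  have "SA21 j i =
      (\<Sum>l=1..N1. 0) +
      (\<Sum>l=1..N2. if l = j then v2 (J j) * meets i j / 2 else 0)"
    unfolding SA21_def SA_entry[OF less]
    by (intro arg_cong2[where f = "(+)"] sum.cong refl)
      (use assms in \<open>auto simp: Sigma_entry_def A_entry_def overlap_def meets_def\<close>)
  then show ?thesis using assms by simp
qed

lemma SA_block22: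
  assumes "j \<in> {1..N2}" "j' \<in> {1..N2}"
  shows "SA22 j j' = (\<Sum>i=1..N1. overlap i j * meets i j') / 2"
proof -
  have less: "N1 + j - 1 < N1 + N2" "N1 + j' - 1 < N1 + N2"
    using assms by auto
  have "SA22 j j' =
      (\<Sum>l=1..N1. overlap l j * meets l j' / 2) +
      (\<Sum>l=1..N2. 0)"
    unfolding SA22_def SA_entry[OF less]
    by (intro arg_cong2[where f = "(+)"] sum.cong refl)
      (use assms in \<open>auto simp: Sigma_entry_def A_entry_def overlap_def meets_def\<close>)
  then show ?thesis by (simp add: sum_divide_distrib)
qed

lemmas SA_block_defs = SA11_def SA12_def SA21_def SA22_def

lemmas SA_blocks = SA_block11 SA_block12 SA_block21 SA_block22

section \<open>Sums over chains as weighted sums over all index vectors\<close>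

lemma sum_interval_chains:
  "(\<Sum>(i, j)\<in>interval_chains N1 N2 I J k. f i j) =
    (\<Sum>i\<in>{1..k} \<rightarrow>\<^sub>E {1..N1}. \<Sum>j\<in>{1..k} \<rightarrow>\<^sub>E {1..N2}.
      (\<Prod>p=1..k. meets (i p) (j p) * meets (i (if p = k then 1 else p + 1)) (j p)) * f i j)"
proof -
  define E where "E = ({1..k} \<rightarrow>\<^sub>E {1..N1}) \<times> ({1..k} \<rightarrow>\<^sub>E {1..N2})"
  define chain where "chain i j \<longleftrightarrow> (\<forall>p\<in>{1..k}. I (i p) \<inter> J (j p) \<noteq> {} \<and>
      J (j p) \<inter> I (i (if p = k then 1 else p + 1)) \<noteq> {})" for i j
  \<comment> \<open>The indicator of a conjunction is the product of the indicators, so the chain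
    condition becomes a product of entries of \<open>H\<close> along the closed path.\<close>
  have chain: "(\<Prod>p=1..k. meets (i p) (j p) * meets (i (if p = k then 1 else p + 1)) (j p)) =
      of_bool (chain i j)" for i j
    unfolding chain_def prod_of_bool[OF finite_atLeastAtMost, symmetric]
    by (intro prod.cong refl) (simp only: meets_def of_bool_conj Int_commute)
  have "finite E"
    by (simp add: E_def finite_PiE)
  moreover have "interval_chains N1 N2 I J k = {x \<in> E. chain (fst x) (snd x)}"
    unfolding interval_chains_def chain_def E_def by (simp only: set_eq_iff) force
  ultimately have "(\<Sum>(i, j)\<in>interval_chains N1 N2 I J k. f i j) =
      (\<Sum>(i, j)\<in>E. of_bool (chain i j) * f i j)"
    by (simp add: sum.inter_filter case_prod_unfold of_bool_def if_distrib[where f = "\<lambda>x. x * _"]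
      cong: if_cong)
  then show ?thesis
    by (simp only: chain E_def sum.cartesian_product)
qed

text \<open>For length 1 the path closes at once and both conditions at p = 1 coincide; the square
  of a 0-1 value is that value.\<close>

lemma sum_interval_chains_1:
  "(\<Sum>(i, j)\<in>interval_chains N1 N2 I J 1. f (i 1) (j 1)) =
    (\<Sum>i=1..N1. \<Sum>j=1..N2. meets i j * f i j)"
  unfolding sum_interval_chains[where f = "\<lambda>i j. f (i 1) (j 1)"] sum_PiE_1
  by (intro sum.cong refl) (simp add: meets_def)

text \<open>The four factors follow the closed path i1, j1, i2, j2, i1.\<close>

lemma sum_interval_chains_2:
  "(\<Sum>(i, j)\<in>interval_chains N1 N2 I J 2. f (i 1) (i 2) (j 1) (j 2)) =
    (\<Sum>i1=1..N1. \<Sum>i2=1..N1. \<Sum>j1=1..N2. \<Sum>j2=1..N2.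
      meets i1 j1 * meets i2 j1 * meets i2 j2 * meets i1 j2 * f i1 i2 j1 j2)"
  unfolding sum_interval_chains[where f = "\<lambda>i j. f (i 1) (i 2) (j 1) (j 2)"] sum_PiE_2
  by (intro sum.cong refl) (simp add: numeral_2_eq_2)

lemma sum_interval_chains_3:
  "(\<Sum>(i, j)\<in>interval_chains N1 N2 I J 3. f (i 1) (i 2) (i 3) (j 1) (j 2) (j 3)) =
    (\<Sum>i1=1..N1. \<Sum>i2=1..N1. \<Sum>i3=1..N1. \<Sum>j1=1..N2. \<Sum>j2=1..N2. \<Sum>j3=1..N2.
      meets i1 j1 * meets i2 j1 * meets i2 j2 * meets i3 j2 * meets i3 j3 * meets i1 j3
      * f i1 i2 i3 j1 j2 j3)"
  unfolding sum_interval_chains[where f = "\<lambda>i j. f (i 1) (i 2) (i 3) (j 1) (j 2) (j 3)"]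
    sum_PiE_3
  by (intro sum.cong refl) (simp add: numeral_3_eq_3 numeral_2_eq_2)

section \<open>The traces of the square and the cube\<close>

context
  assumes v_empty: "v {} = 0"
begin

lemma meets_overlap: "meets i j * overlap i j = overlap i j"
  by (cases "I i \<inter> J j = {}") (simp_all add: meets_def overlap_def v_empty)

text \<open>The trace is Tr PP + Tr QR + Tr RQ + Tr SS. The first and last terms are each a quarter
  of the sum over chains of length 2, the middle two each a quarter of the sum over chains of length
  1.\<close>

lemma trace_SA_square:
  "mat_trace (SA ^\<^sub>m 2) =
    1 / 2 * (\<Sum>(i, j)\<in>interval_chains N1 N2 I J 2. overlap (i 1) (j 1) * overlap (i 2) (j 2))
    + 1 / 2 * (\<Sum>(i, j)\<in>interval_chains N1 N2 I J 1. v1 (I (i 1)) * v2 (J (j 1)))"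
proof -
  \<comment> \<open>The chain weight after \<open>overlap i1 j1\<close> and
    \<open>overlap i2 j2\<close> have absorbed their own \<open>meets\<close> factors.\<close>
  let ?F2 = "\<lambda>i1 i2 j1 j2. overlap i1 j1 * meets i2 j1 * overlap i2 j2 * meets i1 j2"
  let ?c2 = "\<Sum>i1=1..N1. \<Sum>i2=1..N1. \<Sum>j1=1..N2. \<Sum>j2=1..N2. ?F2 i1 i2 j1 j2"
  let ?c1 = "\<Sum>i=1..N1. \<Sum>j=1..N2. meets i j * (v1 (I i) * v2 (J j))"
  have c2: "(\<Sum>(i, j)\<in>interval_chains N1 N2 I J 2.
      overlap (i 1) (j 1) * overlap (i 2) (j 2)) = ?c2"
    unfolding sum_interval_chains_2[where f = "\<lambda>i1 i2 j1 j2. overlap i1 j1 * overlap i2 j2"]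
    by (intro sum.cong refl) (metis meets_overlap mult.assoc mult.commute)
  have c1: "(\<Sum>(i, j)\<in>interval_chains N1 N2 I J 1. v1 (I (i 1)) * v2 (J (j 1))) = ?c1"
    by (rule sum_interval_chains_1)
  have P: "(\<Sum>i1=1..N1. \<Sum>i2=1..N1. SA11 i1 i2 * SA11 i2 i1) = ?c2 / 4"
    by (simp add: SA_blocks sum_product sum_divide_distrib mult.assoc)
  have S: "(\<Sum>j1=1..N2. \<Sum>j2=1..N2. SA22 j1 j2 * SA22 j2 j1) = ?c2 / 4"
  proof -
    have "?c2 = (\<Sum>j1=1..N2. \<Sum>j2=1..N2. \<Sum>i1=1..N1. \<Sum>i2=1..N1. ?F2 i1 i2 j1 j2)"
      by (rule sum_swap_blocks2)
    also have "\<dots> = (\<Sum>j1=1..N2. \<Sum>j2=1..N2. \<Sum>i2=1..N1. \<Sum>i1=1..N1. ?F2 i1 i2 j1 j2)"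
      by (intro sum.cong refl sum.swap)
    finally show ?thesis
      by (simp add: SA_blocks sum_product sum_divide_distrib mult_ac)
  qed
  \<comment> \<open>Both factors contain \<open>meets i j\<close>, and its square collapses.\<close>
  have Q: "(\<Sum>i=1..N1. \<Sum>j=1..N2. SA12 i j * SA21 j i) = ?c1 / 4"
    unfolding sum_divide_distrib
    by (intro sum.cong refl) (auto simp: SA_blocks meets_def)
  have R: "(\<Sum>j=1..N2. \<Sum>i=1..N1. SA21 j i * SA12 i j) = ?c1 / 4"
    unfolding Q[symmetric] by (subst sum.swap) (simp only: mult.commute)
  have "mat_trace (SA ^\<^sub>m 2) =
      (\<Sum>i1=1..N1. \<Sum>i2=1..N1. SA11 i1 i2 * SA11 i2 i1)
      + (\<Sum>i=1..N1. \<Sum>j=1..N2. SA12 i j * SA21 j i)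
      + (\<Sum>j=1..N2. \<Sum>i=1..N1. SA21 j i * SA12 i j)
      + (\<Sum>j1=1..N2. \<Sum>j2=1..N2. SA22 j1 j2 * SA22 j2 j1)"
    unfolding mat_trace_square[OF SA_carrier] sum_lessThan_add_split sum.distrib SA_block_defs
    by (simp only: add_ac)
  then show ?thesis
    unfolding c1 c2 P Q R S by simp
qed

text \<open>Eight words in the blocks occur, each with a factor 1/8 from the three halves in
  \<open>A\<close>. The pure words PPP and SSS give 2/8 of the first sum, the six mixed words give
  6/8 of the second.\<close>

lemma trace_SA_cube:
  "mat_trace (SA ^\<^sub>m 3) =
    1 / 4 * (\<Sum>(i, j)\<in>interval_chains N1 N2 I J 3.
      overlap (i 1) (j 1) * overlap (i 2) (j 2) * overlap (i 3) (j 3))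
    + 3 / 4 * (\<Sum>(i, j)\<in>interval_chains N1 N2 I J 2.
      v1 (I (i 1)) * v2 (J (j 1)) * overlap (i 2) (j 2))"
proof -
  let ?F3 = "\<lambda>i1 i2 i3 j1 j2 j3. overlap i1 j1 * meets i2 j1 * overlap i2 j2 * meets i3 j2
    * overlap i3 j3 * meets i1 j3"
  \<comment> \<open>Only \<open>meets i2 j2\<close> is absorbed here; the other three factors of the
    chain condition remain.\<close>
  let ?F2 = "\<lambda>i1 i2 j1 j2. v1 (I i1) * v2 (J j1) * overlap i2 j2
    * meets i1 j1 * meets i2 j1 * meets i1 j2"
  let ?c3 = "\<Sum>i1=1..N1. \<Sum>i2=1..N1. \<Sum>i3=1..N1. \<Sum>j1=1..N2. \<Sum>j2=1..N2. \<Sum>j3=1..N2.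
    ?F3 i1 i2 i3 j1 j2 j3"
  let ?c2 = "\<Sum>i1=1..N1. \<Sum>i2=1..N1. \<Sum>j1=1..N2. \<Sum>j2=1..N2. ?F2 i1 i2 j1 j2"
  have absorb3: "meets i1 j1 * meets i2 j1 * meets i2 j2 * meets i3 j2 * meets i3 j3 * meets i1 j3
      * (overlap i1 j1 * overlap i2 j2 * overlap i3 j3) =
    (meets i1 j1 * overlap i1 j1) * meets i2 j1 * (meets i2 j2 * overlap i2 j2) * meets i3 j2
      * (meets i3 j3 * overlap i3 j3) * meets i1 j3" for i1 i2 i3 j1 j2 j3
    by (simp only: mult_ac)
  have absorb2: "meets i1 j1 * meets i2 j1 * meets i2 j2 * meets i1 j2
      * (v1 (I i1) * v2 (J j1) * overlap i2 j2) =
    v1 (I i1) * v2 (J j1) * (meets i2 j2 * overlap i2 j2)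
      * meets i1 j1 * meets i2 j1 * meets i1 j2" for i1 i2 j1 j2
    by (simp only: mult_ac)
  have c3: "(\<Sum>(i, j)\<in>interval_chains N1 N2 I J 3.
      overlap (i 1) (j 1) * overlap (i 2) (j 2) * overlap (i 3) (j 3)) = ?c3"
    unfolding sum_interval_chains_3[where
        f = "\<lambda>i1 i2 i3 j1 j2 j3. overlap i1 j1 * overlap i2 j2 * overlap i3 j3"]
    by (simp only: absorb3 meets_overlap)
  have c2: "(\<Sum>(i, j)\<in>interval_chains N1 N2 I J 2.
      v1 (I (i 1)) * v2 (J (j 1)) * overlap (i 2) (j 2)) = ?c2"
    unfolding sum_interval_chains_2[where
        f = "\<lambda>i1 i2 j1 j2. v1 (I i1) * v2 (J j1) * overlap i2 j2"]
    by (simp only: absorb2 meets_overlap)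
  have product3: "sum f A / 2 * (sum g B / 2) * (sum h C / 2) =
      (\<Sum>a\<in>A. \<Sum>b\<in>B. \<Sum>c\<in>C. f a * g b * h c / 8)"
    for f g h :: "nat \<Rightarrow> real" and A B C
  proof -
    have "sum f A / 2 * (sum g B / 2) * (sum h C / 2) = sum f A * sum g B * sum h C / 8"
      by simp
    also have "sum f A * sum g B * sum h C = (\<Sum>a\<in>A. \<Sum>b\<in>B. \<Sum>c\<in>C. f a * g b * h c)"
      unfolding sum_product[of f A g B] by (simp only: sum_distrib_right, simp only: sum_distrib_left)
    finally show ?thesis
      by (simp only: sum_divide_distrib)
  qed
  have PPP: "(\<Sum>i1=1..N1. \<Sum>i2=1..N1. \<Sum>i3=1..N1. SA11 i1 i2 * SA11 i2 i3 * SA11 i3 i1) = ?c3 / 8"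
    unfolding sum_divide_distrib
    by (intro sum.cong refl) (simp only: SA_blocks product3, simp only: mult_ac)
  have SSS: "(\<Sum>j1=1..N2. \<Sum>j2=1..N2. \<Sum>j3=1..N2. SA22 j1 j2 * SA22 j2 j3 * SA22 j3 j1) = ?c3 / 8"
  proof -
    \<comment> \<open>Transposition reverses the orientation of the cycle, whence the order
      \<open>j1, j3, j2\<close>.\<close>
    have "?c3 = (\<Sum>j1=1..N2. \<Sum>j2=1..N2. \<Sum>j3=1..N2. \<Sum>i1=1..N1. \<Sum>i2=1..N1. \<Sum>i3=1..N1.
        ?F3 i1 i2 i3 j1 j2 j3)"
      by (rule sum_swap_blocks3)
    also have "\<dots> = (\<Sum>j1=1..N2. \<Sum>j3=1..N2. \<Sum>j2=1..N2. \<Sum>i1=1..N1. \<Sum>i2=1..N1. \<Sum>i3=1..N1.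
        ?F3 i1 i2 i3 j1 j2 j3)"
      by (intro sum.cong refl sum.swap)
    \<comment> \<open>The I-indices have to follow: in
      \<open>SA22 j1 j3 * SA22 j3 j2 * SA22 j2 j1\<close> the inner summation variables are i1, i3,
      i2 in turn.\<close>
    also have "\<dots> = (\<Sum>j1=1..N2. \<Sum>j3=1..N2. \<Sum>j2=1..N2. \<Sum>i1=1..N1. \<Sum>i3=1..N1. \<Sum>i2=1..N1.
        ?F3 i1 i2 i3 j1 j2 j3)"
      by (intro sum.cong refl sum.swap)
    finally have c3_reversed: "?c3 = \<dots>" .
    show ?thesis
      unfolding c3_reversed sum_divide_distrib
      by (intro sum.cong refl) (simp only: SA_blocks product3, simp only: mult_ac)
  qed
  \<comment> \<open>The index summed inside \<open>SA11 i2 i1\<close> plays j2 in the chain, and j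
    plays j1.\<close>
  have PQR: "(\<Sum>i2=1..N1. \<Sum>i1=1..N1. \<Sum>j=1..N2. SA11 i2 i1 * SA12 i1 j * SA21 j i2) = ?c2 / 8"
    by (subst sum.swap)
      (simp add: SA_blocks sum_divide_distrib sum_distrib_left
        sum_distrib_right mult_ac)
  \<comment> \<open>This word is no rotation of PQR. It yields the same sum because the index inside
    \<open>SA22 j2 j1\<close> plays i2, while i plays i1.\<close>
  have QSR: "(\<Sum>i=1..N1. \<Sum>j2=1..N2. \<Sum>j1=1..N2. SA12 i j2 * SA22 j2 j1 * SA21 j1 i) = ?c2 / 8"
  proof -
    have "?c2 = (\<Sum>i1=1..N1. \<Sum>j1=1..N2. \<Sum>i2=1..N1. \<Sum>j2=1..N2. ?F2 i1 i2 j1 j2)"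
      by (rule sum.cong[OF refl], rule sum.swap)
    also have "\<dots> = (\<Sum>i1=1..N1. \<Sum>j1=1..N2. \<Sum>j2=1..N2. \<Sum>i2=1..N1. ?F2 i1 i2 j1 j2)"
      by (rule sum.cong[OF refl], rule sum.cong[OF refl], rule sum.swap)
    also have "\<dots> = (\<Sum>i1=1..N1. \<Sum>j2=1..N2. \<Sum>j1=1..N2. \<Sum>i2=1..N1. ?F2 i1 i2 j1 j2)"
      by (rule sum.cong[OF refl], rule sum.swap)
    finally show ?thesis
      by (simp add: SA_blocks sum_divide_distrib sum_distrib_left
        sum_distrib_right mult_ac)
  qed
  \<comment> \<open>The remaining four words follow by cyclicity: QRP and RPQ are rotations of PQR,
    and RQS and SRQ are rotations of QSR.\<close>
  have QRP: "(\<Sum>i=1..N1. \<Sum>j=1..N2. \<Sum>i'=1..N1. SA12 i j * SA21 j i' * SA11 i' i) = ?c2 / 8"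
  proof -
    have "(\<Sum>i=1..N1. \<Sum>j=1..N2. \<Sum>i'=1..N1. SA12 i j * SA21 j i' * SA11 i' i) =
        (\<Sum>i=1..N1. \<Sum>i'=1..N1. \<Sum>j=1..N2. SA11 i' i * SA12 i j * SA21 j i')"
      by (rule sum.cong[OF refl], subst sum.swap, simp only: mult_ac)
    also have "\<dots> = ?c2 / 8"
      unfolding PQR[symmetric] by (rule sum.swap)
    finally show ?thesis .
  qed
  have RPQ: "(\<Sum>j=1..N2. \<Sum>i'=1..N1. \<Sum>i=1..N1. SA21 j i' * SA11 i' i * SA12 i j) = ?c2 / 8"
  proof -
    have "(\<Sum>j=1..N2. \<Sum>i'=1..N1. \<Sum>i=1..N1. SA21 j i' * SA11 i' i * SA12 i j) =
        (\<Sum>i'=1..N1. \<Sum>j=1..N2. \<Sum>i=1..N1. SA21 j i' * SA11 i' i * SA12 i j)"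
      by (rule sum.swap)
    also have "\<dots> = ?c2 / 8"
      unfolding PQR[symmetric]
      by (rule sum.cong[OF refl], subst sum.swap, simp only: mult_ac)
    finally show ?thesis .
  qed
  have RQS: "(\<Sum>j1=1..N2. \<Sum>i=1..N1. \<Sum>j2=1..N2. SA21 j1 i * SA12 i j2 * SA22 j2 j1) = ?c2 / 8"
  proof -
    have "(\<Sum>j1=1..N2. \<Sum>i=1..N1. \<Sum>j2=1..N2. SA21 j1 i * SA12 i j2 * SA22 j2 j1) =
        (\<Sum>i=1..N1. \<Sum>j1=1..N2. \<Sum>j2=1..N2. SA21 j1 i * SA12 i j2 * SA22 j2 j1)"
      by (rule sum.swap)
    also have "\<dots> = ?c2 / 8"
      unfolding QSR[symmetric]
      by (rule sum.cong[OF refl], subst sum.swap, simp only: mult_ac)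
    finally show ?thesis .
  qed
  have SRQ: "(\<Sum>j2=1..N2. \<Sum>j1=1..N2. \<Sum>i=1..N1. SA22 j2 j1 * SA21 j1 i * SA12 i j2) = ?c2 / 8"
  proof -
    have "(\<Sum>j2=1..N2. \<Sum>j1=1..N2. \<Sum>i=1..N1. SA22 j2 j1 * SA21 j1 i * SA12 i j2) =
        (\<Sum>j1=1..N2. \<Sum>j2=1..N2. \<Sum>i=1..N1. SA22 j2 j1 * SA21 j1 i * SA12 i j2)"
      by (rule sum.swap)
    also have "\<dots> = (\<Sum>j1=1..N2. \<Sum>i=1..N1. \<Sum>j2=1..N2. SA22 j2 j1 * SA21 j1 i * SA12 i j2)"
      by (intro sum.cong refl sum.swap)
    also have "\<dots> = ?c2 / 8"
      unfolding RQS[symmetric] by (simp only: mult_ac)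
    finally show ?thesis .
  qed
  have "mat_trace (SA ^\<^sub>m 3) =
      (\<Sum>i1=1..N1. \<Sum>i2=1..N1. \<Sum>i3=1..N1. SA11 i1 i2 * SA11 i2 i3 * SA11 i3 i1)
      + (\<Sum>i2=1..N1. \<Sum>i1=1..N1. \<Sum>j=1..N2. SA11 i2 i1 * SA12 i1 j * SA21 j i2)
      + (\<Sum>i=1..N1. \<Sum>j=1..N2. \<Sum>i'=1..N1. SA12 i j * SA21 j i' * SA11 i' i)
      + (\<Sum>i=1..N1. \<Sum>j2=1..N2. \<Sum>j1=1..N2. SA12 i j2 * SA22 j2 j1 * SA21 j1 i)
      + (\<Sum>j=1..N2. \<Sum>i'=1..N1. \<Sum>i=1..N1. SA21 j i' * SA11 i' i * SA12 i j)
      + (\<Sum>j1=1..N2. \<Sum>i=1..N1. \<Sum>j2=1..N2. SA21 j1 i * SA12 i j2 * SA22 j2 j1)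
      + (\<Sum>j2=1..N2. \<Sum>j1=1..N2. \<Sum>i=1..N1. SA22 j2 j1 * SA21 j1 i * SA12 i j2)
      + (\<Sum>j1=1..N2. \<Sum>j2=1..N2. \<Sum>j3=1..N2. SA22 j1 j2 * SA22 j2 j3 * SA22 j3 j1)"
    unfolding mat_trace_cube[OF SA_carrier] sum_lessThan_add_split sum.distrib SA_block_defs
    by (simp only: add_ac)
  then show ?thesis
    unfolding c2 c3 PPP PQR QRP QSR RPQ RQS SRQ SSS by simp
qed

end

end

theorem proposition3:
  fixes T :: real and N1 N2 :: nat and S U :: "nat \<Rightarrow> real"
    and \<sigma>1 \<sigma>2 \<rho> :: "real \<Rightarrow> real"
  defines "I \<equiv> grid_interval S"
    and "J \<equiv> grid_interval U"
    and "v \<equiv> covariation \<rho> \<sigma>1 \<sigma>2"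
    and "v1 \<equiv> variation \<sigma>1"
    and "v2 \<equiv> variation \<sigma>2"
  defines "A \<equiv> A_mat N1 N2 I J"
    and "\<Sigma> \<equiv> Sigma_mat N1 N2 I J v v1 v2"
    and "C \<equiv> interval_chains N1 N2 I J"
  assumes "T > 0"
    and "grid T N1 S" and "grid T N2 U"
    and "\<And>t. t \<in> {0..T} \<Longrightarrow> \<sigma>1 t > 0"
    and "\<And>t. t \<in> {0..T} \<Longrightarrow> \<sigma>2 t > 0"
    and "\<And>t. t \<in> {0..T} \<Longrightarrow> \<rho> t \<in> {-1..1}"
    and "set_integrable lebesgue {0..T} (\<lambda>t. (\<sigma>1 t)\<^sup>2)"
    and "set_integrable lebesgue {0..T} (\<lambda>t. (\<sigma>2 t)\<^sup>2)"
    and "set_integrable lebesgue {0..T} (\<lambda>t. \<rho> t * \<sigma>1 t * \<sigma>2 t)"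
  shows "(mat_trace ((\<Sigma> * A) ^\<^sub>m 2) =
      1 / 2 * (\<Sum>(i, j)\<in>C 2. \<Prod>p=1..2. v (I (i p) \<inter> J (j p)))
      + 1 / 2 * (\<Sum>(i, j)\<in>C 1. v1 (I (i 1)) * v2 (J (j 1))))
    \<and> (mat_trace ((\<Sigma> * A) ^\<^sub>m 3) =
      1 / 4 * (\<Sum>(i, j)\<in>C 3. \<Prod>p=1..3. v (I (i p) \<inter> J (j p)))
      + 3 / 4 * (\<Sum>(i, j)\<in>C 2. v1 (I (i 1)) * v2 (J (j 1)) * v (I (i 2) \<inter> J (j 2))))"
proof -
  \<comment> \<open>The integrand is multiplied by the indicator of the empty set. This is the
    property of \<open>v\<close> on which the absorption of \<open>meets\<close> rests.\<close>
  have v0: "v {} = 0"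
    by (simp add: v_def covariation_def set_lebesgue_integral_def)
  have SA: "SA N1 N2 I J v v1 v2 = \<Sigma> * A"
    by (simp add: SA_def \<Sigma>_def A_def)
  have prods: "(\<Prod>p=1..2. f p) = f 1 * f 2" "(\<Prod>p=1..3. f p) = f 1 * f 2 * f 3"
    for f :: "nat \<Rightarrow> real"
    by (simp_all add: numeral_2_eq_2 numeral_3_eq_3)
  show ?thesis
    using trace_SA_square[of v N1 N2 I J v1 v2, OF v0]
      trace_SA_cube[of v N1 N2 I J v1 v2, OF v0]
    unfolding SA prods overlap_def C_def by blast
qed

end
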